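(* Let $q$ be a prime power. For integers $0<\rho<n\le m$, $$K_R(q^m,n,\rho)\le \frac{q^{mn}}{v(\rho)}\left(\ln v(\rho)+\gamma+\frac{1}{2v(\rho)+1/3}\right),$$ where $\gamma$ is the Euler–Mascheroni constant.
   Context: For $\mathbf{x}\in \mathrm{GF}(q^m)^n$, $\mathrm{rk}(\mathbf{x})$ is the maximum number of coordinates of $\mathbf{x}$ that are linearly independent over $\mathrm{GF}(q)$; the rank distance is $d_R(\mathbf{x},\mathbf{y})=\mathrm{rk}(\mathbf{x}-\mathbf{y})$. $v(\rho)$ is the number of vectors in a ball of rank radius $\rho$ in $\mathrm{GF}(q^m)^n$. The rank covering radius of a nonempty code $C\subseteq \mathrm{GF}(q^m)^n$ is $\max_{\mathbf{x}}\min_{\mathbf{c}\in C} d_R(\mathbf{x},\mathbf{c})$. $K_R(q^m,n,\rho)$ denotes the minimum number of balls of rank radius $\rho$ needed to cover $\mathrm{GF}(q^m)^n$, i.e. the minimum cardinality of a (not necessarily linear) code $C\subseteq\mathrm{GF}(q^m)^n$ with rank covering radius at most $\rho$. *)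

theory Defs
  imports "HOL-Algebra.Embedded_Algebras" "HOL-Analysis.Harmonic_Numbers"
    "HOL-Number_Theory.Prime_Powers"
begin

text \<open>
  Throughout, \<open>F\<close> plays the role of $\mathrm{GF}(q^m)$, \<open>K\<close> that of its subfield
  $\mathrm{GF}(q)$, and vectors of length \<open>n\<close> are lists.
\<close>

definition vecs :: "('a, 'b) ring_scheme \<Rightarrow> nat \<Rightarrow> 'a list set" where
  "vecs F n = {x. length x = n \<and> set x \<subseteq> carrier F}"

text \<open>
  \<open>ring.independent\<close> is a predicate on lists, so a repeated coordinate counts as a
  dependency; coordinates are therefore selected by their positions \<open>I\<close>.
\<close>

definition rk :: "('a, 'b) ring_scheme \<Rightarrow> 'a set \<Rightarrow> 'a list \<Rightarrow> nat" where
  "rk F K x = Max {card I |I. I \<subseteq> {..<length x} \<and> ring.independent F K (nths x I)}"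

definition rank_dist :: "('a, 'b) ring_scheme \<Rightarrow> 'a set \<Rightarrow> 'a list \<Rightarrow> 'a list \<Rightarrow> nat" where
  "rank_dist F K x y = rk F K (map2 (a_minus F) x y)"

definition rank_ball ::
  "('a, 'b) ring_scheme \<Rightarrow> 'a set \<Rightarrow> nat \<Rightarrow> 'a list \<Rightarrow> nat \<Rightarrow> 'a list set" where
  "rank_ball F K n c \<rho> = {x \<in> vecs F n. rank_dist F K x c \<le> \<rho>}"

text \<open>All balls of the same radius have the same size (\<open>card_rank_ball\<close> below).\<close>

definition ball_volume :: "('a, 'b) ring_scheme \<Rightarrow> 'a set \<Rightarrow> nat \<Rightarrow> nat \<Rightarrow> nat" where
  "ball_volume F K n \<rho> = card (rank_ball F K n (replicate n \<zero>\<^bsub>F\<^esub>) \<rho>)"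

definition covering_radius ::
  "('a, 'b) ring_scheme \<Rightarrow> 'a set \<Rightarrow> nat \<Rightarrow> 'a list set \<Rightarrow> nat" where
  "covering_radius F K n C = Max ((\<lambda>x. Min (rank_dist F K x ` C)) ` vecs F n)"

definition K_R :: "('a, 'b) ring_scheme \<Rightarrow> 'a set \<Rightarrow> nat \<Rightarrow> nat \<Rightarrow> nat" where
  "K_R F K n \<rho> =
     (LEAST k. \<exists>C. C \<subseteq> vecs F n \<and> C \<noteq> {} \<and> covering_radius F K n C \<le> \<rho> \<and> card C = k)"

lemma card_rank_ball:
  assumes "ring F" and c: "c \<in> vecs F n"
  shows "card (rank_ball F K n c \<rho>) = ball_volume F K n \<rho>"
proof -
  interpret ring F by fact
  let ?z = "replicate n \<zero>\<^bsub>F\<^esub>"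
  have in_carr: "x ! i \<in> carrier F" if "x \<in> vecs F n" "i < n" for x i
    using that by (auto simp: vecs_def)
  have vecsI: "x \<in> vecs F n" if "length x = n" "\<And>i. i < n \<Longrightarrow> x ! i \<in> carrier F" for x
    using that by (auto simp: vecs_def set_conv_nth)
  have len: "length x = n" if "x \<in> vecs F n" for x
    using that by (simp add: vecs_def)
  have minus: "map2 (a_minus F) x c \<in> vecs F n" if "x \<in> vecs F n" for x
    using that c by (intro vecsI) (auto simp: len in_carr)
  have plus: "map2 (add F) x c \<in> vecs F n" if "x \<in> vecs F n" for x
    using that c by (intro vecsI) (auto simp: len in_carr)
  have zero: "map2 (a_minus F) x ?z = x" if "x \<in> vecs F n" for x
    using that by (intro nth_equalityI) (auto simp: len in_carr minus_eq)
  have pm: "map2 (a_minus F) (map2 (add F) x c) c = x" if "x \<in> vecs F n" for x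
    using that c by (intro nth_equalityI) (auto simp: len in_carr minus_eq a_assoc r_neg)
  have mp: "map2 (add F) (map2 (a_minus F) x c) c = x" if "x \<in> vecs F n" for x
    using that c by (intro nth_equalityI) (auto simp: len in_carr minus_eq a_assoc l_neg)
  have "bij_betw (\<lambda>x. map2 (a_minus F) x c) (rank_ball F K n c \<rho>) (rank_ball F K n ?z \<rho>)"
    by (rule bij_betwI[where g = "\<lambda>x. map2 (add F) x c"])
       (auto simp: rank_ball_def rank_dist_def zero minus plus pm mp)
  then show ?thesis
    by (simp add: ball_volume_def bij_betw_same_card)
qed

end

theory Submission
  imports Defs "HOL-Real_Asymp.Real_Asymp"
begin

text \<open>
  A greedy code repeatedly adds the centre whose ball meets the uncovered set \<open>U\<close> in the largest
  number \<open>k\<close> of points. The potential $\sum_c H_{|B(c) \cap U|}$, which is $q^{mn} H_{v(\rho)}$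
  at the start, drops by at least $v(\rho)$ in each step: every newly covered point lies in
  $v(\rho)$ balls, and removing it from a ball costs that ball at least $1/k$. Hence
  $v(\rho) K_R \le q^{mn} H_{v(\rho)}$. The bound
  $H_v \le \ln v + \gamma + 1/(2v+1/3)$ holds because
  $H_v - \ln v - 1/(2v+1/3)$ increases to $\gamma$.
\<close>

text \<open>The difference is a sum of \<open>a - b\<close> reciprocals of positive integers that
  are at most \<open>k\<close>. It prices the loss of points by a set with at most \<open>k\<close>
  uncovered ones.\<close>

lemma harm_diff_ge:
  assumes "b \<le> a" "a \<le> k"
  shows "(real a - real b) / real k \<le> harm a - harm b"
proof -
  have "harm b + (real a - real b) / real k \<le> harm a"
    using assms
  proof (induction a rule: dec_induct)
    case (step j)
    have "1 / real k \<le> inverse (real (Suc j))"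
      using step by (simp add: divide_simps)
    with step show ?case
      by (simp add: harm_Suc diff_divide_distrib add_divide_distrib)
  qed simp
  then show ?thesis by simp
qed

text \<open>Keeping the potential of the uncovered set \<open>U\<close> itself on the right, rather
  than a bound on it, lets the drops telescope in the induction; the degree condition passes to
  subsets of \<open>U\<close>.\<close>

lemma greedy_cover:
  fixes A :: "'i \<Rightarrow> 'a set" and d :: nat
  assumes "finite I" "finite U" "0 < d"
    and "\<And>x. x \<in> U \<Longrightarrow> d \<le> card {i \<in> I. x \<in> A i}"
  shows "\<exists>C \<subseteq> I. U \<subseteq> (\<Union>i\<in>C. A i) \<and> real (d * card C) \<le> (\<Sum>i\<in>I. harm (card (A i \<inter> U)))"
  using assms(2,4)
proof (induction "card U" arbitrary: U rule: less_induct)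
  case less
  show ?case
  proof (cases "U = {}")
    case True
    then show ?thesis by (intro exI[of _ "{}"]) (auto simp: sum_nonneg harm_nonneg)
  next
    case False
    \<comment> \<open>As \<open>d\<close> is positive, some set meets \<open>U\<close>. So the
      greedy maximum \<open>k\<close> exists and is positive, which makes \<open>U\<close> shrink
      and allows division by \<open>k\<close>.\<close>
    then obtain x where x: "x \<in> U" by blast
    with less.prems(2) \<open>0 < d\<close> have "card {i \<in> I. x \<in> A i} \<noteq> 0" by fastforce
    then obtain i where i: "i \<in> I" "x \<in> A i" by (auto simp: card_eq_0_iff)
    define a where "a = (\<lambda>U i. card (A i \<inter> U))"
    have "Max (a U ` I) \<in> a U ` I" using i \<open>finite I\<close> by (intro Max_in) auto
    then obtain c where c: "c \<in> I" "a U c = Max (a U ` I)" by auto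
    define k where "k = a U c"
    have le_k: "a U j \<le> k" if "j \<in> I" for j
      using that c \<open>finite I\<close> by (simp add: k_def)
    have "0 < a U i" using x i less.prems(1) by (auto simp: a_def card_gt_0_iff)
    with le_k[OF i(1)] have "0 < k" by simp
    define W where "W = U - A c"
    have "A c \<inter> U \<noteq> {}" using \<open>0 < k\<close> by (auto simp: k_def a_def)
    then have "card W < card U"
      unfolding W_def using less.prems(1) by (intro psubset_card_mono) auto
    moreover have "d \<le> card {i \<in> I. y \<in> A i}" if "y \<in> W" for y
      using that less.prems(2) by (simp add: W_def)
    moreover have "finite W" using less.prems(1) by (simp add: W_def)
    ultimately have "\<exists>C\<subseteq>I. W \<subseteq> (\<Union>i\<in>C. A i)
        \<and> real (d * card C) \<le> (\<Sum>i\<in>I. harm (card (A i \<inter> W)))"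
      by (intro less.hyps)
    then obtain C where C: "C \<subseteq> I" "W \<subseteq> (\<Union>i\<in>C. A i)"
      and card_C: "real (d * card C) \<le> (\<Sum>i\<in>I. harm (a W i))"
      unfolding a_def by blast
    \<comment> \<open>The points that set \<open>j\<close> loses are the newly covered ones it
      contains.\<close>
    have a_diff: "a U j = a W j + card {x \<in> A c \<inter> U. x \<in> A j}" for j
    proof -
      have "A j \<inter> U = (A j \<inter> W) \<union> {x \<in> A c \<inter> U. x \<in> A j}" by (auto simp: W_def)
      then show ?thesis
        unfolding a_def using less.prems(1)
        by (simp add: card_Un_disjoint W_def disjoint_iff)
    qed
    \<comment> \<open>Double counting of pairs of a newly covered point and a set containing it:
      there are \<open>k\<close> such points, each in at least \<open>d\<close> sets.\<close>
    have "d * k \<le> (\<Sum>x\<in>A c \<inter> U. card {j \<in> I. x \<in> A j})"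
      using sum_bounded_below[of "A c \<inter> U" d "\<lambda>x. card {j \<in> I. x \<in> A j}"] less.prems
      by (simp add: k_def a_def mult.commute)
    also have "\<dots> = (\<Sum>j\<in>I. card {x \<in> A c \<inter> U. x \<in> A j})"
      using sum.swap_restrict[of "A c \<inter> U" I "\<lambda>_ _. 1::nat" "\<lambda>x j. x \<in> A j"]
        \<open>finite I\<close> less.prems(1) by simp
    finally have "real (d * k) \<le> real (\<Sum>j\<in>I. card {x \<in> A c \<inter> U. x \<in> A j})"
      by (rule of_nat_mono)
    then have "real d \<le> real (\<Sum>j\<in>I. card {x \<in> A c \<inter> U. x \<in> A j}) / real k"
      using \<open>0 < k\<close> by (simp add: pos_le_divide_eq)
    also have "\<dots> = (\<Sum>j\<in>I. (real (a U j) - real (a W j)) / real k)"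
      by (simp add: a_diff sum_divide_distrib)
    also have "\<dots> \<le> (\<Sum>j\<in>I. harm (a U j) - harm (a W j))"
      using le_k a_diff by (intro sum_mono harm_diff_ge) auto
    finally have drop: "real d \<le> (\<Sum>j\<in>I. harm (a U j)) - (\<Sum>j\<in>I. harm (a W j))"
      by (simp add: sum_subtractf)
    \<comment> \<open>Only an inequality: the \<open>C\<close> from the induction hypothesis may
      already contain \<open>c\<close>.\<close>
    have "card (insert c C) \<le> Suc (card C)"
      by (rule card_insert_le_m1) auto
    then have "real (d * card (insert c C)) \<le> real d + real (d * card C)"
      by (metis mult_Suc_right mult_le_mono2 of_nat_add of_nat_le_iff)
    with drop card_C have "real (d * card (insert c C)) \<le> (\<Sum>j\<in>I. harm (a U j))"
      by linarith
    then show ?thesis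
      using C c unfolding a_def by (intro exI[of _ "insert c C"]) (auto simp: W_def)
  qed
qed

lemma harm_step_bound:
  fixes x :: real
  assumes "1 \<le> x"
  shows "0 \<le> 1 / (x + 1) - ln (x + 1) + ln x - 3 / (6 * x + 7) + 3 / (6 * x + 1)"
proof -
  define g where "g = (\<lambda>x::real. 1 / (x + 1) - ln (x + 1) + ln x - 3 / (6 * x + 7) + 3 / (6 * x + 1))"
  define g' where "g' = (\<lambda>x::real. 1 / (x * (x + 1)\<^sup>2) - 432 * (3 * x + 2) / ((6 * x + 7) * (6 * x + 1))\<^sup>2)"
  have deriv: "(g has_real_derivative g' y) (at y)" if "1 \<le> y" for y
  proof -
    have nz: "y + 1 \<noteq> 0" "y \<noteq> 0" "6 * y + 7 \<noteq> 0" "6 * y + 1 \<noteq> 0" using that by auto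
    have "(g has_real_derivative
        (- 1 / (y + 1)\<^sup>2 - 1 / (y + 1) + 1 / y + 18 / (6 * y + 7)\<^sup>2 - 18 / (6 * y + 1)\<^sup>2)) (at y)"
      unfolding g_def using that
      by (auto intro!: derivative_eq_intros simp: power2_eq_square)
    moreover have "- 1 / (y + 1)\<^sup>2 - 1 / (y + 1) + 1 / y = 1 / (y * (y + 1)\<^sup>2)"
      using nz by (simp add: divide_simps, simp add: power2_eq_square algebra_simps)
    moreover have "18 / (6 * y + 7)\<^sup>2 - 18 / (6 * y + 1)\<^sup>2
        = - (432 * (3 * y + 2) / ((6 * y + 7) * (6 * y + 1))\<^sup>2)"
      using nz by (simp add: divide_simps power_mult_distrib, simp add: power2_eq_square algebra_simps)
    ultimately show ?thesis
      unfolding g'_def by (elim DERIV_cong) linarith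
  qed
  have neg: "g' y \<le> 0" if "1 \<le> y" for y
  proof -
    \<comment> \<open>Cross-multiplying reduces the sign of \<open>g'\<close> to this polynomial.
      The quartic terms cancel, and the cubic ones do so precisely because the constant is 1/3; the
      rest is positive for y at least 1.\<close>
    have "432 * (3 * y + 2) * (y * (y + 1)\<^sup>2) - ((6 * y + 7) * (6 * y + 1))\<^sup>2
        = 216 * y\<^sup>2 + 192 * y - 49"
      by (simp add: power2_eq_square algebra_simps)
    moreover have "0 \<le> 216 * y\<^sup>2" by simp
    ultimately have "((6 * y + 7) * (6 * y + 1))\<^sup>2 \<le> 432 * (3 * y + 2) * (y * (y + 1)\<^sup>2)"
      using that by linarith
    moreover have "0 < (6 * y + 7) * (6 * y + 1)" "0 < y * (y + 1)\<^sup>2"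
      using that by simp_all
    ultimately show ?thesis
      using that unfolding g'_def by (simp add: divide_simps)
  qed
  have "(g \<longlongrightarrow> 0) at_top"
    unfolding g_def by real_asymp
  moreover have "\<forall>\<^sub>F y in at_top. g y \<le> g x"
    using eventually_ge_at_top[of x]
  proof eventually_elim
    case (elim y)
    show ?case
    proof (rule DERIV_nonpos_imp_nonincreasing[OF elim])
      fix t assume "x \<le> t" "t \<le> y"
      with assms deriv[of t] neg[of t] show "\<exists>z. (g has_real_derivative z) (at t) \<and> z \<le> 0"
        by auto
    qed
  qed
  ultimately have "0 \<le> g x"
    by (intro tendsto_upperbound) auto
  then show ?thesis by (simp add: g_def)
qed

lemma harm_le_euler_mascheroni:
  assumes "0 < n"
  shows "harm n \<le> ln (real n) + euler_mascheroni + 1 / (2 * real n + 1 / 3)"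
proof -
  \<comment> \<open>The shift to \<open>Suc n\<close> keeps the argument at least 1, as
    \<open>harm_step_bound\<close> demands.\<close>
  define f where "f = (\<lambda>n. harm (Suc n) - ln (real (Suc n)) - 1 / (2 * real (Suc n) + 1 / 3))"
  have "incseq f"
  proof (rule incseq_SucI)
    fix n
    have "1 / (2 * real (Suc n) + 1 / 3) = 3 / (6 * real (Suc n) + 1)"
      "1 / (2 * real (Suc (Suc n)) + 1 / 3) = 3 / (6 * real (Suc n) + 7)"
      by (simp_all add: divide_simps)
    moreover have "real (Suc (Suc n)) = real (Suc n) + 1" by simp
    ultimately show "f n \<le> f (Suc n)"
      using harm_step_bound[of "real (Suc n)"]
      unfolding f_def harm_Suc[of "Suc n"] inverse_eq_divide by simp
  qed
  moreover have "f \<longlonglongrightarrow> euler_mascheroni"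
  proof -
    have "(\<lambda>n. 1 / (2 * real (Suc n) + 1 / 3)) \<longlonglongrightarrow> 0" by real_asymp
    with LIMSEQ_Suc[OF euler_mascheroni_LIMSEQ]
    have "(\<lambda>n. harm (Suc n) - ln (real (Suc n)) - 1 / (2 * real (Suc n) + 1 / 3))
        \<longlonglongrightarrow> euler_mascheroni - 0"
      by (rule tendsto_diff)
    then show ?thesis by (simp add: f_def)
  qed
  ultimately have "f (n - 1) \<le> euler_mascheroni" by (rule incseq_le)
  with assms have "harm n - ln (real n) - 1 / (2 * real n + 1 / 3) \<le> euler_mascheroni"
    unfolding f_def by (metis Suc_pred')
  then show ?thesis by linarith
qed

text \<open>The involution sending c to x - c carries the centres whose balls contain
  \<open>x\<close> to the ball around zero, since the distance from \<open>x\<close> to c is the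
  rank of x - c. This gives the degree \<open>d\<close> for \<open>greedy_cover\<close>.\<close>

lemma card_rank_ball_centres:
  assumes "ring F" and x: "x \<in> vecs F n"
  shows "card {c \<in> vecs F n. x \<in> rank_ball F K n c \<rho>} = ball_volume F K n \<rho>"
proof -
  interpret ring F by fact
  let ?z = "replicate n \<zero>\<^bsub>F\<^esub>"
  let ?g = "map2 (a_minus F) x"
  have in_carr: "y ! i \<in> carrier F" if "y \<in> vecs F n" "i < n" for y i
    using that by (auto simp: vecs_def)
  have vecsI: "y \<in> vecs F n" if "length y = n" "\<And>i. i < n \<Longrightarrow> y ! i \<in> carrier F" for y
    using that by (auto simp: vecs_def set_conv_nth)
  have len: "length y = n" if "y \<in> vecs F n" for y
    using that by (simp add: vecs_def)
  have closed: "?g y \<in> vecs F n" if "y \<in> vecs F n" for y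
    using that x by (intro vecsI) (auto simp: len in_carr)
  have zero: "map2 (a_minus F) y ?z = y" if "y \<in> vecs F n" for y
    using that by (intro nth_equalityI) (auto simp: len in_carr minus_eq)
  have "a \<ominus>\<^bsub>F\<^esub> (a \<ominus>\<^bsub>F\<^esub> b) = b" if "a \<in> carrier F" "b \<in> carrier F" for a b
    using that by algebra
  then have invol: "?g (?g y) = y" if "y \<in> vecs F n" for y
    using that x by (intro nth_equalityI) (auto simp: len in_carr)
  have "bij_betw ?g {c \<in> vecs F n. x \<in> rank_ball F K n c \<rho>} (rank_ball F K n ?z \<rho>)"
    by (rule bij_betwI[where g = ?g])
       (use x in \<open>auto simp: rank_ball_def rank_dist_def zero closed invol\<close>)
  then show ?thesis
    by (simp add: ball_volume_def bij_betw_same_card)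
qed

text \<open>A nonempty selection starts with zero, which lies in the span of the remaining entries,
  so only the empty selection is independent. It puts the centre in its ball and so makes the volume
  positive.\<close>

lemma rk_replicate_zero:
  assumes "ring F" "subfield K F"
  shows "rk F K (replicate n \<zero>\<^bsub>F\<^esub>) = 0"
proof -
  interpret ring F by fact
  let ?z = "replicate n \<zero>\<^bsub>F\<^esub>"
  have "I = {}" if I: "I \<subseteq> {..<n}" "independent K (nths ?z I)" for I
  proof (cases "nths ?z I")
    case Nil
    then have "set (nths ?z I) = {}" by simp
    with I(1) show ?thesis by (auto simp: set_nths)
  next
    case (Cons a as)
    have "a \<in> set ?z" using Cons in_set_nthsD[of a ?z I] by simp
    then have "a = \<zero>\<^bsub>F\<^esub>" by simp
    with I(2) Cons have "\<zero>\<^bsub>F\<^esub> \<notin> Span K as" "set as \<subseteq> carrier F"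
      using independent_backwards(1,2) independent_in_carrier by metis+
    then show ?thesis using Span_subgroup_props(2)[OF assms(2)] by blast
  qed
  moreover have "independent K (nths ?z {})" by simp
  ultimately have "I \<subseteq> {..<length ?z} \<and> independent K (nths ?z I) \<longleftrightarrow> I = {}" for I
    by (metis empty_subsetI length_replicate)
  then show ?thesis by (simp only: rk_def) simp
qed

theorem corollary7:
  fixes F :: "('a, 'b) ring_scheme" and K :: "'a set" and q m n \<rho> :: nat
  assumes "primepow q"
    and "field F" and "order F = q ^ m"
    and "subfield K F" and "card K = q"
    and "0 < \<rho>" and "\<rho> < n" and "n \<le> m"
  defines "v \<equiv> real (ball_volume F K n \<rho>)"
  shows "real (K_R F K n \<rho>) \<le>
    real q ^ (m * n) / v * (ln v + euler_mascheroni + 1 / (2 * v + 1 / 3))"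
proof -
  interpret field F by fact
  have F: "ring F" by unfold_locales
  let ?V = "vecs F n" and ?B = "\<lambda>c. rank_ball F K n c \<rho>"
  have "0 < order F" using assms primepow_gt_0_nat by simp
  then have fin_F: "finite (carrier F)" by (simp add: order_def card_gt_0_iff)
  have V: "?V = {x. set x \<subseteq> carrier F \<and> length x = n}" by (auto simp: vecs_def)
  have fin_V: "finite ?V" unfolding V using fin_F by (rule finite_lists_length_eq)
  have card_V: "card ?V = q ^ (m * n)"
    unfolding V using fin_F assms(3) by (simp add: card_lists_length_eq order_def power_mult)
  let ?z = "replicate n \<zero>\<^bsub>F\<^esub>"
  have z: "?z \<in> ?V" by (auto simp: vecs_def)
  have "map2 (a_minus F) ?z ?z = ?z" by (intro nth_equalityI) (auto simp: minus_eq)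
  then have "rank_dist F K ?z ?z = 0"
    unfolding rank_dist_def using rk_replicate_zero[OF F assms(4)] by (simp only:)
  then have "?z \<in> ?B ?z"
    using z by (simp add: rank_ball_def)
  moreover have "finite (?B ?z)" using fin_V by (simp add: rank_ball_def)
  ultimately have vol_pos: "0 < ball_volume F K n \<rho>"
    by (auto simp: ball_volume_def card_gt_0_iff)
  \<comment> \<open>Centres and points to be covered both range over the whole space, with the ball
    volume as degree.\<close>
  obtain C where C: "C \<subseteq> ?V" "?V \<subseteq> (\<Union>c\<in>C. ?B c)"
    and le: "real (ball_volume F K n \<rho> * card C) \<le> (\<Sum>c\<in>?V. harm (card (?B c \<inter> ?V)))"
    using greedy_cover[OF fin_V fin_V vol_pos, of ?B] card_rank_ball_centres[OF F, of _ n K \<rho>]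
    by auto
  have fin_C: "finite C" using C(1) fin_V by (rule finite_subset)
  have "C \<noteq> {}" using C(2) z by auto
  moreover have "covering_radius F K n C \<le> \<rho>"
  proof -
    have "Min (rank_dist F K x ` C) \<le> \<rho>" if "x \<in> ?V" for x
    proof -
      from that C(2) obtain c where "c \<in> C" "rank_dist F K x c \<le> \<rho>"
        by (auto simp: rank_ball_def)
      with fin_C show ?thesis by (meson Min_le finite_imageI image_eqI order_trans)
    qed
    then show ?thesis
      unfolding covering_radius_def using fin_V z by (subst Max_le_iff) auto
  qed
  ultimately have "K_R F K n \<rho> \<le> card C"
    unfolding K_R_def using C(1) by (intro Least_le) auto
  \<comment> \<open>At the start nothing is covered, so each of the $q^{mn}$ balls counts with its
    full volume in the potential.\<close>
  have "?B c \<inter> ?V = ?B c" for c by (auto simp: rank_ball_def)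
  then have "v * real (card C) \<le> real q ^ (m * n) * harm (ball_volume F K n \<rho>)"
    using le by (simp add: v_def card_rank_ball[OF F] card_V)
  also have "\<dots> \<le> real q ^ (m * n) * (ln v + euler_mascheroni + 1 / (2 * v + 1 / 3))"
    unfolding v_def using harm_le_euler_mascheroni[OF vol_pos] by (rule mult_left_mono) simp
  finally have "real (card C) \<le> real q ^ (m * n) / v * (ln v + euler_mascheroni + 1 / (2 * v + 1 / 3))"
    using vol_pos by (simp add: v_def pos_le_divide_eq mult.commute)
  with \<open>K_R F K n \<rho> \<le> card C\<close> show ?thesis by linarith
qed

end
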